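(* Let $G$ be a connected (finite, simple) graph with $n$ vertices. Then $G$ is properly quasi-transitively colourable if and only if there exists an induced proper subgraph $H$ of $G$ such that: (i) $H$ is connected; (ii) $2 \leq |V(H)| \leq n-1$; and (iii) for every vertex $v \in V(G)\setminus V(H)$, if $v$ is adjacent to some vertex of $V(H)$, then $v$ is adjacent to every vertex of $V(H)$.
   Context: A quasi-transitive $2$-edge-colouring of a graph $G$ is a map $c: E(G)\to\{R,B\}$ such that for all pairs of edges $xy, yz \in E(G)$ with $c(xy)\neq c(yz)$, we have $xz\in E(G)$. Such a colouring is trivial if it is constant on $E(G)$. A graph is properly quasi-transitively colourable if it admits a nontrivial quasi-transitive $2$-edge-colouring. *)

theory Defs
  imports "Graph_Theory.Graph_Theory"
begin

text \<open>
  A finite simple graph is a \<open>pair_graph\<close>: a finite, loop-free digraph whose arc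
  relation is symmetric. Each undirected edge thus corresponds to two opposite arcs.
  Edge colourings are defined on the two-element sets of endpoints, so that both arcs
  carry the same colour.
\<close>

definition edges :: "'a pair_pre_digraph \<Rightarrow> 'a set set" where
  "edges G = {{u, v} | u v. (u, v) \<in> parcs G}"

datatype colour = Red | Blue

text \<open>
  A colouring is a total function on vertex sets. Only its values on \<open>edges G\<close> matter
  in the following definitions.
\<close>

definition quasi_transitive_colouring ::
    "'a pair_pre_digraph \<Rightarrow> ('a set \<Rightarrow> colour) \<Rightarrow> bool" where
  "quasi_transitive_colouring G c \<longleftrightarrow>
     (\<forall>x y z. {x, y} \<in> edges G \<longrightarrow> {y, z} \<in> edges G \<longrightarrow> c {x, y} \<noteq> c {y, z} \<longrightarrow> {x, z} \<in> edges G)"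

definition trivial_colouring ::
    "'a pair_pre_digraph \<Rightarrow> ('a set \<Rightarrow> colour) \<Rightarrow> bool" where
  "trivial_colouring G c \<longleftrightarrow> (\<exists>k. \<forall>e \<in> edges G. c e = k)"

definition properly_quasi_transitively_colourable :: "'a pair_pre_digraph \<Rightarrow> bool" where
  "properly_quasi_transitively_colourable G \<longleftrightarrow>
     (\<exists>c. quasi_transitive_colouring G c \<and> \<not> trivial_colouring G c)"

end

theory Submission
  imports Defs
begin

text \<open>
  Regard non-edges as a third colour. Quasi-transitivity then says that the resulting
  3-colouring of the complete graph has no rainbow triangle. By Gallai's theorem some colour
  class is disconnected, and since no triangle is rainbow, a vertex outside a component
  of one colour sees that component in a single colour. If Red or Blue is
  disconnected, a component of that colour with an edge is therefore the required subgraph. If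
  only the non-edges are disconnected, then there are at least three co-components, as two would
  be joined in one colour only, which would disconnect the other; the union of two
  co-components is the required subgraph.
  Conversely, colour the edges inside \<open>H\<close> red and all other edges blue.
\<close>

section \<open>Rainbow-free colourings and the components of one colour\<close>

text \<open>For symmetric \<open>f\<close> a triple with a repeated vertex repeats a value, so
  quantifying over all triples constrains genuine triangles only.\<close>

definition rainbow_free :: "('a \<Rightarrow> 'a \<Rightarrow> 'c) \<Rightarrow> 'a set \<Rightarrow> bool" where
  "rainbow_free f S \<longleftrightarrow> (\<forall>x\<in>S. \<forall>y\<in>S. \<forall>z\<in>S. \<not> distinct [f x y, f y z, f x z])"

text \<open>For symmetric \<open>f\<close>, a witness that the graph on \<open>S\<close> formed by
  the pairs of value \<open>k\<close> is disconnected.\<close>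

definition colour_cut :: "('a \<Rightarrow> 'a \<Rightarrow> 'c) \<Rightarrow> 'a set \<Rightarrow> 'c \<Rightarrow> 'a set \<Rightarrow> bool" where
  "colour_cut f S k A \<longleftrightarrow> A \<noteq> {} \<and> A \<subset> S \<and> (\<forall>a\<in>A. \<forall>b\<in>S - A. f a b \<noteq> k)"

definition colour_rel :: "('a \<Rightarrow> 'a \<Rightarrow> 'c) \<Rightarrow> 'a set \<Rightarrow> 'c \<Rightarrow> 'a rel" where
  "colour_rel f S k = {(x, y). x \<in> S \<and> y \<in> S \<and> f x y = k}"

definition colour_component :: "('a \<Rightarrow> 'a \<Rightarrow> 'c) \<Rightarrow> 'a set \<Rightarrow> 'c \<Rightarrow> 'a \<Rightarrow> 'a set" where
  "colour_component f S k x = (colour_rel f S k)\<^sup>* `` {x}"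

lemma rainbow_freeD:
  assumes "rainbow_free f S" "x \<in> S" "y \<in> S" "z \<in> S"
    and "f x y \<noteq> f y z" "f x y \<noteq> f x z"
  shows "f y z = f x z"
  using assms unfolding rainbow_free_def by auto

lemma rainbow_free_subset: "rainbow_free f S \<Longrightarrow> T \<subseteq> S \<Longrightarrow> rainbow_free f T"
  unfolding rainbow_free_def by blast

lemma colour_component_refl: "x \<in> colour_component f S k x"
  unfolding colour_component_def by simp

lemma colour_component_subset:
  assumes "x \<in> S" shows "colour_component f S k x \<subseteq> S"
proof
  fix y assume "y \<in> colour_component f S k x"
  then have "(x, y) \<in> (colour_rel f S k)\<^sup>*" by (simp add: colour_component_def)
  then show "y \<in> S" using assms by induct (auto simp: colour_rel_def)
qed

lemma colour_component_step:
  assumes "y \<in> colour_component f S k x" "y \<in> S" "z \<in> S" "f y z = k"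
  shows "z \<in> colour_component f S k x"
  using assms unfolding colour_component_def
  by (auto simp: colour_rel_def intro: rtrancl.rtrancl_into_rtrancl)

text \<open>Induction along paths in least-closed-set form: with \<open>A\<close> the set of
  vertices having a wanted property, the property follows on the whole component.\<close>

lemma colour_component_closed_subset:
  assumes "x \<in> A" and "\<And>y z. y \<in> A \<Longrightarrow> y \<in> S \<Longrightarrow> z \<in> S \<Longrightarrow> f y z = k \<Longrightarrow> z \<in> A"
  shows "colour_component f S k x \<subseteq> A"
proof
  fix y assume "y \<in> colour_component f S k x"
  then have "(x, y) \<in> (colour_rel f S k)\<^sup>*" by (simp add: colour_component_def)
  then show "y \<in> A" using assms by induct (auto simp: colour_rel_def)
qed

lemma colour_component_eq:
  assumes sym: "\<And>x y. f x y = f y x" and "y \<in> colour_component f S k x"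
  shows "colour_component f S k y = colour_component f S k x"
proof -
  have "sym ((colour_rel f S k)\<^sup>*)"
    by (rule sym_rtrancl) (auto simp: sym_def colour_rel_def sym)
  then show ?thesis
    using assms(2) unfolding colour_component_def
    by (auto dest: symD intro: rtrancl_trans)
qed

lemma colour_component_commute:
  assumes "\<And>x y. f x y = f y x" and "y \<in> colour_component f S k x"
  shows "x \<in> colour_component f S k y"
  unfolding colour_component_eq[where f = f, OF assms] by (rule colour_component_refl)

text \<open>Steps of colour \<open>k\<close> never cross the cut, so the component stays on the side
  containing \<open>x\<close>, and the other side is nonempty.\<close>

lemma colour_component_psubset:
  assumes sym: "\<And>x y. f x y = f y x" and cut: "colour_cut f S k A" and "x \<in> S"
  shows "colour_component f S k x \<subset> S"
proof -
  have "colour_component f S k x \<noteq> S"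
  proof (cases "x \<in> A")
    case True
    then have "colour_component f S k x \<subseteq> A"
      using cut by (intro colour_component_closed_subset) (auto simp: colour_cut_def)
    then show ?thesis using cut by (auto simp: colour_cut_def)
  next
    case False
    have "z \<notin> A" if "y \<notin> A" "y \<in> S" "f y z = k" for y z
      using that cut sym[of y z] by (auto simp: colour_cut_def)
    then have "colour_component f S k x \<subseteq> - A"
      using False by (intro colour_component_closed_subset) auto
    then show ?thesis using cut by (auto simp: colour_cut_def)
  qed
  then show ?thesis using colour_component_subset[OF \<open>x \<in> S\<close>, of f k] by blast
qed

text \<open>If \<open>u w\<close> has colour \<open>k\<close> inside the component, then
  \<open>u y\<close> and \<open>w y\<close> avoid \<open>k\<close> because \<open>y\<close> lies
  outside; the triangle is not rainbow, so these two agree. Thus the colour towards \<open>y\<close>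
  spreads along the component.\<close>

lemma colour_component_uniform:
  assumes sym: "\<And>x y. f x y = f y x" and rf: "rainbow_free f S"
    and "x \<in> S" "y \<in> S" and y: "y \<notin> colour_component f S k x"
    and "z \<in> colour_component f S k x"
  shows "f z y = f x y"
proof -
  let ?C = "colour_component f S k x"
  have "?C \<subseteq> {z \<in> ?C. f z y = f x y}"
  proof (rule colour_component_closed_subset)
    show "x \<in> {z \<in> ?C. f z y = f x y}" by (simp add: colour_component_refl)
  next
    fix u w assume u: "u \<in> {z \<in> ?C. f z y = f x y}" "u \<in> S" and w: "w \<in> S" "f u w = k"
    then have wC: "w \<in> ?C" using colour_component_step by fastforce
    have "f u y \<noteq> k" "f w y \<noteq> k"
      using u w wC y \<open>y \<in> S\<close> colour_component_step by fastforce+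
    then have "f w y = f u y"
      using rainbow_freeD[OF rf \<open>u \<in> S\<close> \<open>w \<in> S\<close> \<open>y \<in> S\<close>] w by simp
    then show "w \<in> {z \<in> ?C. f z y = f x y}" using wC u by simp
  qed
  then show ?thesis using assms(6) by blast
qed

section \<open>Gallai's theorem by induction on the vertices\<close>

text \<open>Suppose \<open>k\<close>, \<open>p\<close> and \<open>q\<close> all connect
  \<open>insert v T\<close>. Then \<open>v\<close> has a \<open>k\<close>-neighbour in every
  \<open>k\<close>-component of \<open>T\<close>, and a vertex that \<open>v\<close> sees in another
  colour repeats that colour towards all other \<open>k\<close>-components. A
  \<open>p\<close>-neighbour and a \<open>q\<close>-neighbour of \<open>v\<close> then contradict
  each other.\<close>

lemma gallai_vertex_extension:
  assumes sym: "\<And>x y. f x y = f y x" and rf: "rainbow_free f (insert v T)" and "v \<notin> T"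
    and cut: "colour_cut f T k A" and pq: "p \<noteq> k" "q \<noteq> k" "p \<noteq> q"
  shows "\<exists>l\<in>{k, p, q}. \<exists>B. colour_cut f (insert v T) l B"
proof (rule ccontr)
  assume no: "\<not> ?thesis"
  let ?C = "colour_component f T k"
  have rfT: "rainbow_free f T" using rf by (rule rainbow_free_subset) blast
  have "T \<noteq> {}" using cut by (auto simp: colour_cut_def)
  have reach: "\<exists>x\<in>T. f v x = l" if "l \<in> {k, p, q}" for l
  proof -
    have "\<not> colour_cut f (insert v T) l {v}" using no that by blast
    then show ?thesis using \<open>v \<notin> T\<close> \<open>T \<noteq> {}\<close> by (auto simp: colour_cut_def)
  qed
  \<comment> \<open>A \<open>k\<close>-component of \<open>T\<close> without a
    \<open>k\<close>-neighbour of \<open>v\<close> would still be a cut after adding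
    \<open>v\<close>. The name \<open>red\<close> refers to the colour \<open>k\<close>, whichever
    it is.\<close>
  have red: "\<exists>z\<in>?C y. f v z = k" if "y \<in> T" for y
  proof (rule ccontr)
    assume none: "\<not> (\<exists>z\<in>?C y. f v z = k)"
    have sub: "?C y \<subseteq> T" using that by (rule colour_component_subset)
    have "colour_cut f (insert v T) k (?C y)"
      unfolding colour_cut_def
    proof (intro conjI ballI)
      show "?C y \<noteq> {}" using colour_component_refl by fastforce
      show "?C y \<subset> insert v T" using sub \<open>v \<notin> T\<close> by blast
      fix a b assume a: "a \<in> ?C y" and b: "b \<in> insert v T - ?C y"
      show "f a b \<noteq> k"
      proof (cases "b = v")
        case True then show ?thesis using none a sym[of a v] by auto
      next
        case False
        then show ?thesis using a b sub colour_component_step[OF a] by blast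
      qed
    qed
    then show False using no by blast
  qed
  \<comment> \<open>Let \<open>z\<close> be a \<open>k\<close>-neighbour of \<open>v\<close> in the
    component of \<open>y\<close>. In the triangle \<open>v\<close>, \<open>z\<close>,
    \<open>x\<close> only \<open>v z\<close> has colour \<open>k\<close>, so \<open>z x\<close> has
    the colour of \<open>v x\<close>; uniformity carries this from \<open>z\<close> to
    \<open>y\<close>.\<close>
  have copy: "f x y = f v x" if "x \<in> T" "y \<in> T" "y \<notin> ?C x" "f v x \<noteq> k" for x y
  proof -
    obtain z where z: "z \<in> ?C y" "f v z = k" using red[OF \<open>y \<in> T\<close>] by blast
    have zT: "z \<in> T" using z colour_component_subset[OF \<open>y \<in> T\<close>, of f k] by blast
    have x: "x \<notin> ?C y"
      using that(3) colour_component_commute[where f = f, OF sym] by metis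
    have "f z x = f y x"
      using colour_component_uniform[where f = f, OF sym rfT \<open>y \<in> T\<close> \<open>x \<in> T\<close> x z(1)] .
    moreover have "f z x \<noteq> k" using colour_component_step[OF z(1) zT \<open>x \<in> T\<close>] x by blast
    then have "f z x = f v x"
      using rainbow_freeD[OF rf, of v z x] zT \<open>x \<in> T\<close> z(2) that(4) by auto
    ultimately show ?thesis using sym[of x y] by simp
  qed
  obtain x where x: "x \<in> T" "f v x = p" using reach by blast
  obtain x' where x': "x' \<in> T" "f v x' = q" using reach by blast
  \<comment> \<open>In different components, the pair \<open>x x'\<close> would have both colours
    \<open>p\<close> and \<open>q\<close>. In the same component, a vertex \<open>y\<close> outside
    it, which exists by the cut of \<open>T\<close>, would see \<open>x\<close> in \<open>p\<close>
    and \<open>x'\<close> in \<open>q\<close>, against uniformity.\<close>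
  show False
  proof (cases "x' \<in> ?C x")
    case False
    then have "x \<notin> ?C x'"
      using colour_component_commute[where f = f, OF sym] by metis
    then have "f x' x = q" using copy x x' pq by simp
    moreover have "f x x' = p" using copy x x' pq False by simp
    ultimately show False using sym[of x x'] pq by simp
  next
    case True
    obtain y where y: "y \<in> T" "y \<notin> ?C x"
      using colour_component_psubset[where f = f, OF sym cut x(1)] by blast
    have "f x' y = f x y" using colour_component_uniform[where f = f, OF sym rfT x(1) y True] .
    moreover have "f x y = p" using copy x y pq by simp
    moreover have "f x' y = q"
      using copy x' y pq colour_component_eq[where f = f, OF sym True] by simp
    ultimately show False using pq by simp
  qed
qed

text \<open>The cut colour of the smaller set may become connected through the new vertex; the
  extension lemma then yields a cut in one of the other two colours. The base case is a pair: any
  colour other than its single value is cut.\<close>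

theorem gallai_disconnected_colour:
  assumes "finite S" and "2 \<le> card S" and sym: "\<And>x y. f x y = f y x"
    and "rainbow_free f S" and "distinct [p, q, r]"
  shows "\<exists>k\<in>{p, q, r}. \<exists>A. colour_cut f S k A"
  using assms(1,2,4)
proof (induction S rule: finite_induct)
  case empty
  then show ?case by simp
next
  case (insert v T)
  have rf: "rainbow_free f T" using insert.prems(2) by (rule rainbow_free_subset) blast
  show ?case
  proof (cases "2 \<le> card T")
    case True
    then obtain k A where k: "k \<in> {p, q, r}" and cut: "colour_cut f T k A"
      using insert.IH rf by blast
    have ext: "\<exists>l\<in>{k, s, t}. \<exists>B. colour_cut f (insert v T) l B"
      if "s \<noteq> k" "t \<noteq> k" "s \<noteq> t" for s t
      using gallai_vertex_extension[OF sym insert.prems(2) insert.hyps(2) cut that] .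
    from k consider "k = p" | "k = q" | "k = r" by blast
    then show ?thesis
    proof cases
      case 1 then show ?thesis using ext[of q r] assms(5) by auto
    next
      case 2 then show ?thesis using ext[of p r] assms(5) by auto
    next
      case 3 then show ?thesis using ext[of p q] assms(5) by auto
    qed
  next
    case False
    then have "card T = 1" using insert.prems(1) insert.hyps by simp
    then obtain w where T: "T = {w}" by (auto simp: card_1_singleton_iff)
    obtain k where "k \<in> {p, q, r}" "f v w \<noteq> k" using assms(5) by auto
    then have "colour_cut f (insert v T) k {v}"
      using T insert.hyps by (auto simp: colour_cut_def)
    then show ?thesis using \<open>k \<in> {p, q, r}\<close> by blast
  qed
qed

section \<open>Connectedness expressed by cuts\<close>

text \<open>Translates path-based connectedness into the language of \<open>colour_cut\<close>. A
  path cannot leave a set without outgoing edges; conversely, the set reachable from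
  \<open>u\<close> has none.\<close>

lemma connected_iff_no_cut:
  fixes H :: "'a pair_pre_digraph"
  shows "Digraph_Component.connected (with_proj H) \<longleftrightarrow> pverts H \<noteq> {} \<and>
    (\<forall>A. A \<noteq> {} \<longrightarrow> A \<subset> pverts H \<longrightarrow> (\<exists>a\<in>A. \<exists>b\<in>pverts H - A. {a, b} \<in> edges H))"
    (is "_ \<longleftrightarrow> _ \<and> ?cuts")
proof -
  let ?E = "{(a, b). {a, b} \<in> edges H}"
  have arcs: "parcs (mk_symmetric (with_proj H)) = ?E"
    by (force simp: parcs_mk_symmetric edges_def doubleton_eq_iff)
  have conn: "Digraph_Component.connected (with_proj H) \<longleftrightarrow> pverts H \<noteq> {} \<and>
      (\<forall>u\<in>pverts H. \<forall>v\<in>pverts H. (u, v) \<in> rtrancl_on (pverts H) ?E)"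
    by (simp add: Digraph_Component.connected_def strongly_connected_def reachable_def arcs)
  have reach_imp_cuts: "?cuts" if all: "\<forall>u\<in>pverts H. \<forall>v\<in>pverts H. (u, v) \<in> rtrancl_on (pverts H) ?E"
  proof (intro allI impI, rule ccontr)
    fix A assume A: "A \<noteq> {}" "A \<subset> pverts H"
      and no: "\<not> (\<exists>a\<in>A. \<exists>b\<in>pverts H - A. {a, b} \<in> edges H)"
    obtain u v where u: "u \<in> A" and v: "v \<in> pverts H - A" using A by blast
    have "(u, v) \<in> rtrancl_on (pverts H) ?E" using all u v A by blast
    then have "v \<in> A" by (induct rule: rtrancl_on_induct) (use no u in auto)
    then show False using v by blast
  qed
  have cuts_imp_reach: "(u, v) \<in> rtrancl_on (pverts H) ?E"
    if cuts: ?cuts and u: "u \<in> pverts H" and v: "v \<in> pverts H" for u v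
  proof (rule ccontr)
    assume nr: "(u, v) \<notin> rtrancl_on (pverts H) ?E"
    let ?A = "{w \<in> pverts H. (u, w) \<in> rtrancl_on (pverts H) ?E}"
    have "?A \<noteq> {}" "?A \<subset> pverts H" using u v nr by auto
    then obtain a b where "a \<in> ?A" "b \<in> pverts H - ?A" "{a, b} \<in> edges H"
      using cuts by meson
    then show False by (auto intro: rtrancl_on_into_rtrancl_on)
  qed
  have "(\<forall>u\<in>pverts H. \<forall>v\<in>pverts H. (u, v) \<in> rtrancl_on (pverts H) ?E) \<longleftrightarrow> ?cuts"
    by (rule iffI, erule reach_imp_cuts, intro ballI, rule cuts_imp_reach)
  then show ?thesis unfolding conn by (rule arg_cong)
qed

section \<open>Induced subgraphs as connected modules\<close>

context pair_graph
begin

lemma edges_iff: "{x, y} \<in> edges G \<longleftrightarrow> (x, y) \<in> parcs G"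
  using pair_sym_arcs unfolding edges_def symmetric_def
  by (auto simp: doubleton_eq_iff dest: symD)

lemma edges_verts: "{x, y} \<in> edges G \<Longrightarrow> x \<in> pverts G \<and> y \<in> pverts G \<and> x \<noteq> y"
  using edges_iff in_arcsD1 in_arcsD2 pair_no_loops by fastforce

text \<open>The conditions on \<open>H\<close> in terms of its vertex set alone, which determines an
  induced subgraph: a proper module (homogeneous set) with at least two vertices that induces a
  connected subgraph.\<close>

definition connected_module :: "'a set \<Rightarrow> bool" where
  "connected_module C \<longleftrightarrow> C \<subset> pverts G \<and> 2 \<le> card C \<and>
    (\<forall>A. A \<noteq> {} \<longrightarrow> A \<subset> C \<longrightarrow> (\<exists>a\<in>A. \<exists>b\<in>C - A. {a, b} \<in> edges G)) \<and>
    (\<forall>v\<in>pverts G - C. (\<exists>w\<in>C. {v, w} \<in> edges G) \<longrightarrow> (\<forall>w\<in>C. {v, w} \<in> edges G))"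

lemma induced_edges_iff:
  assumes "induced_subgraph (with_proj H) (with_proj G)"
  shows "{x, y} \<in> edges H \<longleftrightarrow> x \<in> pverts H \<and> y \<in> pverts H \<and> {x, y} \<in> edges G"
proof -
  have "parcs H = {e \<in> parcs G. fst e \<in> pverts H \<and> snd e \<in> pverts H}"
    using assms by (simp add: induced_subgraph_def)
  then show ?thesis by (auto simp: edges_def doubleton_eq_iff)
qed

lemma induced_subgraph_iff_connected_module:
  "(\<exists>H. induced_subgraph (with_proj H) (with_proj G) \<and> H \<noteq> G \<and>
       Digraph_Component.connected (with_proj H) \<and>
       2 \<le> card (pverts H) \<and> card (pverts H) \<le> card (pverts G) - 1 \<and>
       (\<forall>v \<in> pverts G - pverts H.
          (\<exists>w \<in> pverts H. {v, w} \<in> edges G) \<longrightarrow> (\<forall>w \<in> pverts H. {v, w} \<in> edges G)))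
   \<longleftrightarrow> (\<exists>C. connected_module C)" (is "(\<exists>H. ?P H) \<longleftrightarrow> _")
proof
  assume "\<exists>H. ?P H"
  then obtain H where ind: "induced_subgraph (with_proj H) (with_proj G)"
    and conn: "Digraph_Component.connected (with_proj H)"
    and card: "2 \<le> card (pverts H)" "card (pverts H) \<le> card (pverts G) - 1"
    and uniform: "\<forall>v \<in> pverts G - pverts H.
      (\<exists>w \<in> pverts H. {v, w} \<in> edges G) \<longrightarrow> (\<forall>w \<in> pverts H. {v, w} \<in> edges G)"
    by (elim exE conjE)
  have "pverts H \<subseteq> pverts G"
    using ind by (auto simp: induced_subgraph_def subgraph_def)
  \<comment> \<open>Subtraction is truncated, so the upper bound is strict only for nonempty
    \<open>pverts G\<close>; the lower bound 2 excludes the empty case.\<close>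
  moreover have "pverts H \<noteq> pverts G" using card by auto
  ultimately have "pverts H \<subset> pverts G" by (rule psubsetI)
  moreover have "\<exists>a\<in>A. \<exists>b\<in>pverts H - A. {a, b} \<in> edges G"
    if A: "A \<noteq> {}" "A \<subset> pverts H" for A
  proof -
    obtain a b where "a \<in> A" "b \<in> pverts H - A" "{a, b} \<in> edges H"
      using conn A unfolding connected_iff_no_cut by meson
    then show ?thesis using induced_edges_iff[OF ind, of a b] by blast
  qed
  ultimately have "connected_module (pverts H)"
    using card(1) uniform by (simp add: connected_module_def)
  then show "\<exists>C. connected_module C" by blast
next
  assume "\<exists>C. connected_module C"
  then obtain C where C: "connected_module C" by blast
  define H where "H = \<lparr>pverts = C, parcs = {e \<in> parcs G. fst e \<in> C \<and> snd e \<in> C}\<rparr>"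
  have V: "pverts H = C" by (simp add: H_def)
  have "wf_digraph (with_proj H)" by unfold_locales (auto simp: H_def)
  then have ind: "induced_subgraph (with_proj H) (with_proj G)"
    using C wf_digraph_axioms
    by (auto simp: induced_subgraph_def subgraph_def compatible_def H_def connected_module_def)
  have "C \<noteq> {}" using C by (auto simp: connected_module_def)
  moreover have "\<exists>a\<in>A. \<exists>b\<in>C - A. {a, b} \<in> edges H" if A: "A \<noteq> {}" "A \<subset> C" for A
  proof -
    obtain a b where "a \<in> A" "b \<in> C - A" "{a, b} \<in> edges G"
      using C A unfolding connected_module_def by meson
    then show ?thesis using induced_edges_iff[OF ind, of a b] A V by blast
  qed
  ultimately have "Digraph_Component.connected (with_proj H)"
    unfolding connected_iff_no_cut V by blast
  moreover have "card C < card (pverts G)"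
    using C pair_finite_verts by (auto simp: connected_module_def intro: psubset_card_mono)
  ultimately have "?P H"
    using ind C V unfolding connected_module_def by auto
  then show "\<exists>H. ?P H" by blast
qed

section \<open>From a connected module to a colouring\<close>

lemma connected_module_imp_colourable:
  assumes "Digraph_Component.connected (with_proj G)" and C: "connected_module C"
  shows "properly_quasi_transitively_colourable G"
proof -
  define c where "c e = (if e \<subseteq> C then Red else Blue)" for e :: "'a set"
  \<comment> \<open>A red and a blue edge with common vertex \<open>y\<close> have \<open>y\<close>
    in \<open>C\<close> and the far end \<open>z\<close> of the blue one outside, so the module
    condition joins \<open>z\<close> to the far end \<open>x\<close> of the red one.\<close>
  have mod: "{x, z} \<in> edges G"
    if "x \<in> C" "y \<in> C" "z \<notin> C" "{y, z} \<in> edges G" for x y z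
  proof -
    have "z \<in> pverts G - C" using that edges_verts by blast
    moreover have "{z, y} \<in> edges G" using that by (simp add: insert_commute)
    ultimately have "{z, x} \<in> edges G"
      using C that(1,2) unfolding connected_module_def by blast
    then show ?thesis by (simp add: insert_commute)
  qed
  have "{x, z} \<in> edges G"
    if "{x, y} \<in> edges G" "{y, z} \<in> edges G" "c {x, y} \<noteq> c {y, z}" for x y z
  proof (cases "{x, y} \<subseteq> C")
    case True
    then show ?thesis using mod[of x y z] that by (auto simp: c_def split: if_splits)
  next
    case False
    then have "{y, z} \<subseteq> C" "x \<notin> C" using that by (auto simp: c_def split: if_splits)
    then show ?thesis using mod[of z y x] that by (auto simp: insert_commute)
  qed
  then have qt: "quasi_transitive_colouring G c"
    unfolding quasi_transitive_colouring_def by blast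
  have C_props: "C \<subset> pverts G" "C \<noteq> {}" "2 \<le> card C"
    using C by (auto simp: connected_module_def)
  then obtain w where w: "w \<in> C" by blast
  \<comment> \<open>Both colours occur: connectedness of \<open>C\<close> across the cut
    \<open>{w}\<close> gives a red edge, connectedness of \<open>G\<close> across \<open>C\<close> a
    blue one.\<close>
  have "{w} \<subset> C" using w C_props(3) by (cases "C = {w}") auto
  then obtain a b where red: "a \<in> C" "b \<in> C" "{a, b} \<in> edges G"
    using C unfolding connected_module_def by (meson DiffD1 insert_not_empty psubsetD)
  obtain a' b' where blue: "a' \<in> C" "b' \<in> pverts G - C" "{a', b'} \<in> edges G"
    using assms(1) C_props unfolding connected_iff_no_cut by meson
  have "c {a, b} = Red" "c {a', b'} = Blue" using red blue by (auto simp: c_def)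
  then have "\<not> trivial_colouring G c"
    using red(3) blue(3) unfolding trivial_colouring_def by (metis colour.distinct(1))
  then show ?thesis using qt unfolding properly_quasi_transitively_colourable_def by blast
qed

section \<open>From a colouring to a connected module\<close>

lemma colourable_imp_connected_module:
  assumes "properly_quasi_transitively_colourable G"
  shows "\<exists>C. connected_module C"
proof -
  obtain c where qt: "quasi_transitive_colouring G c" and nt: "\<not> trivial_colouring G c"
    using assms unfolding properly_quasi_transitively_colourable_def by blast
  let ?V = "pverts G"
  define f where "f x y = (if {x, y} \<in> edges G then Some (c {x, y}) else None)" for x y
  have sym: "f x y = f y x" for x y by (simp add: f_def insert_commute)
  have edge: "{x, y} \<in> edges G \<longleftrightarrow> f x y \<noteq> None" for x y by (simp add: f_def)
  \<comment> \<open>If no edge had colour \<open>k\<close>, all edges would have the other colour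
    and the colouring would be trivial.\<close>
  have coloured: "\<exists>x y. {x, y} \<in> edges G \<and> c {x, y} = k" for k
  proof -
    obtain e where "e \<in> edges G" "c e = k"
      using nt colour.exhaust[of k] unfolding trivial_colouring_def by (metis colour.exhaust)
    then show ?thesis unfolding edges_def by blast
  qed
  \<comment> \<open>If one of three distinct values were \<open>None\<close>, the others would be
    edges of different colours and quasi-transitivity would make the third pair an edge. So all
    three are edges, and two colours cannot give three distinct values.\<close>
  have "\<not> distinct [f x y, f y z, f x z]" for x y z
  proof
    assume d: "distinct [f x y, f y z, f x z]"
    have qtD: "f u w \<noteq> None" if "f u v \<noteq> None" "f v w \<noteq> None" "f u v \<noteq> f v w" for u v w
      using qt that unfolding quasi_transitive_colouring_def by (auto simp: f_def split: if_splits)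
    have ne: "f x y \<noteq> f y z" "f x y \<noteq> f x z" "f y z \<noteq> f x z" using d by auto
    have "f x y \<noteq> None" using ne qtD[of x z y] sym[of y z] by metis
    moreover have "f y z \<noteq> None" using ne qtD[of y x z] sym[of x y] by metis
    moreover have "f x z \<noteq> None" using ne qtD[of x y z] by metis
    ultimately obtain r s t where "f x y = Some r" "f y z = Some s" "f x z = Some t" by blast
    then show False using ne by (cases r; cases s; cases t) auto
  qed
  then have rf: "rainbow_free f ?V" unfolding rainbow_free_def by blast
  obtain x0 y0 where e0: "{x0, y0} \<in> edges G" using coloured by blast
  have card2: "2 \<le> card X" if "{x, y} \<in> edges G" "x \<in> X" "y \<in> X" "X \<subseteq> ?V" for x y X
  proof -
    have "card {x, y} = 2" using edges_verts[OF that(1)] by simp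
    moreover have "card {x, y} \<le> card X"
      using that pair_finite_verts by (intro card_mono) (auto dest: finite_subset)
    ultimately show ?thesis by simp
  qed
  have cut: "\<exists>k\<in>{None, Some Red, Some Blue}. \<exists>A. colour_cut f ?V k A"
    using gallai_disconnected_colour[OF pair_finite_verts _ sym rf] card2[OF e0, of ?V]
      edges_verts[OF e0] by simp
  show ?thesis
  proof (cases "\<exists>k A. colour_cut f ?V (Some k) A")
    case True
    then obtain k A where cutk: "colour_cut f ?V (Some k) A" by blast
    \<comment> \<open>Starting from an edge of colour \<open>k\<close> ensures that the component
      has two vertices.\<close>
    obtain x y where xy: "{x, y} \<in> edges G" "c {x, y} = k" using coloured by blast
    have xV: "x \<in> ?V" "y \<in> ?V" using edges_verts[OF xy(1)] by auto
    let ?C = "colour_component f ?V (Some k) x"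
    have yC: "y \<in> ?C"
      using colour_component_step[OF colour_component_refl xV, of f "Some k"] xy by (simp add: f_def)
    have psub: "?C \<subset> ?V" using colour_component_psubset[where f = f, OF sym cutk xV(1)] .
    have "\<exists>a\<in>A. \<exists>b\<in>?C - A. {a, b} \<in> edges G" if A: "A \<noteq> {}" "A \<subset> ?C" for A
    proof (rule ccontr)
      assume no: "\<not> ?thesis"
      obtain a where a: "a \<in> A" using A by blast
      have Ca: "colour_component f ?V (Some k) a = ?C"
        by (rule colour_component_eq[where f = f, OF sym]) (use a A in blast)
      have "colour_component f ?V (Some k) a \<subseteq> A"
      proof (rule colour_component_closed_subset[OF a])
        fix u w assume u: "u \<in> A" "u \<in> ?V" "w \<in> ?V" "f u w = Some k"
        then have "w \<in> ?C" using A colour_component_step by fastforce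
        then show "w \<in> A" using no u edge[of u w] by auto
      qed
      then show False using Ca A by blast
    qed
    \<comment> \<open>Uniformity fixes the value towards \<open>v\<close>, hence also whether it is
      \<open>None\<close>, that is, a non-edge.\<close>
    moreover have "{v, w'} \<in> edges G"
      if "v \<in> ?V - ?C" "w \<in> ?C" "{v, w} \<in> edges G" "w' \<in> ?C" for v w w'
    proof -
      have "f w v = f x v" "f w' v = f x v"
        using colour_component_uniform[where f = f, OF sym rf xV(1)] that by auto
      then show ?thesis using that(3) edge sym by metis
    qed
    ultimately have "connected_module ?C"
      unfolding connected_module_def
      using psub card2[OF xy(1) colour_component_refl yC] by (intro conjI) blast+
    then show ?thesis by blast
  next
    case False
    then obtain A where cutN: "colour_cut f ?V None A" using cut by auto
    let ?K = "colour_component f ?V None"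
    obtain a where aV: "a \<in> ?V" using cutN by (auto simp: colour_cut_def)
    obtain b where b: "b \<in> ?V" "b \<notin> ?K a"
      using colour_component_psubset[where f = f, OF sym cutN aV] by blast
    have bV: "b \<in> ?V" using b by simp
    have KV: "?K a \<subseteq> ?V" "?K b \<subseteq> ?V" using colour_component_subset aV bV by fast+
    \<comment> \<open>Components of colour \<open>None\<close> are the co-components: vertices of
      different ones are adjacent.\<close>
    have join: "{u, w} \<in> edges G" if "u \<in> ?K x" "u \<in> ?V" "w \<in> ?V" "w \<notin> ?K x" for u w x
      using colour_component_step that edge by fast
    have disj: "u \<notin> ?K a" if "u \<in> ?K b" for u
    proof
      assume "u \<in> ?K a"
      then have "?K a = ?K b"
        using that colour_component_eq[where f = f, OF sym] by metis
      then show False using b(2) colour_component_refl by metis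
    qed
    let ?C = "?K a \<union> ?K b"
    have "?C \<noteq> ?V"
    proof
      assume V: "?C = ?V"
      have same: "f u w = f a b" if "u \<in> ?K a" "w \<in> ?K b" for u w
      proof -
        have "f u w = f a w"
          using colour_component_uniform[where f = f, OF sym rf aV _ disj that(1)] that KV by blast
        moreover have "a \<notin> ?K b" using disj colour_component_refl by fast
        then have "f w a = f b a"
          using colour_component_uniform[where f = f, OF sym rf bV aV _ that(2)] by blast
        ultimately show ?thesis using sym by metis
      qed
      \<comment> \<open>All pairs between \<open>?K a\<close> and \<open>?K b\<close> have the value
        \<open>f a b\<close>, so a colour \<open>k\<close> different from it is cut by
        \<open>?K a\<close>, contrary to the case assumption.\<close>
      obtain k where "f a b \<noteq> Some k" by (metis colour.distinct(1) option.inject)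
      then have "colour_cut f ?V (Some k) (?K a)"
        unfolding colour_cut_def
      proof (intro conjI ballI)
        show "?K a \<noteq> {}" using colour_component_refl by fast
        show "?K a \<subset> ?V" using KV b by blast
        fix u w assume "u \<in> ?K a" and "w \<in> ?V - ?K a"
        then have "f u w = f a b" using same V by blast
        then show "f u w \<noteq> Some k" using \<open>f a b \<noteq> Some k\<close> by simp
      qed
      then show False using False by blast
    qed
    then have psub: "?C \<subset> ?V" using KV by blast
    have ab: "{a, b} \<in> edges G" using join[OF colour_component_refl] aV b by blast
    have "\<exists>u\<in>A. \<exists>w\<in>?C - A. {u, w} \<in> edges G" if A: "A \<noteq> {}" "A \<subset> ?C" for A
    proof (rule ccontr)
      assume no: "\<not> ?thesis"
      have ed: "{u, w} \<in> edges G" "{w, u} \<in> edges G" if "u \<in> ?K a" "w \<in> ?K b" for u w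
        using join[of u a w] disj that KV by (auto simp: insert_commute)
      have ab_refl: "a \<in> ?K a" "b \<in> ?K b" by (rule colour_component_refl)+
      \<comment> \<open>\<open>?K a\<close> and \<open>?K b\<close> are completely joined, so a set
        closed under edges within the union that meets one contains the other, and therefore
        both.\<close>
      have 1: "?K b \<subseteq> A" if "u \<in> A" "u \<in> ?K a" for u
      proof
        fix w assume "w \<in> ?K b"
        then show "w \<in> A" using no ed(1)[OF that(2)] that(1) by blast
      qed
      have 2: "?K a \<subseteq> A" if "u \<in> A" "u \<in> ?K b" for u
      proof
        fix w assume "w \<in> ?K a"
        then show "w \<in> A" using no ed(2)[OF _ that(2)] that(1) by blast
      qed
      obtain u where "u \<in> A" "u \<in> ?C" using A by blast
      then have "?K a \<subseteq> A \<or> ?K b \<subseteq> A" using 1 2 by (metis UnE)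
      then have "a \<in> A \<or> b \<in> A" using ab_refl by blast
      then have "?C \<subseteq> A"
      proof
        assume "a \<in> A"
        then have "?K b \<subseteq> A" by (rule 1[OF _ ab_refl(1)])
        moreover have "?K a \<subseteq> A" by (rule 2[OF _ ab_refl(2)]) (use calculation ab_refl in blast)
        ultimately show ?thesis by (simp only: Un_subset_iff)
      next
        assume "b \<in> A"
        then have "?K a \<subseteq> A" by (rule 2[OF _ ab_refl(2)])
        moreover have "?K b \<subseteq> A" by (rule 1[OF _ ab_refl(1)]) (use calculation ab_refl in blast)
        ultimately show ?thesis by (simp only: Un_subset_iff)
      qed
      then show False using A by blast
    qed
    \<comment> \<open>A vertex outside the union lies in a further co-component and is adjacent to
      the whole union.\<close>
    moreover have "{v, w} \<in> edges G" if "v \<in> ?V - ?C" "w \<in> ?C" for v w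
      using join[of w a v] join[of w b v] that KV by (auto simp: insert_commute)
    moreover have "2 \<le> card ?C"
      by (rule card2[OF ab]) (use KV in \<open>simp_all add: colour_component_refl\<close>)
    ultimately have "connected_module ?C"
      unfolding connected_module_def using psub by (intro conjI) blast+
    then show ?thesis by blast
  qed
qed

end

theorem theorem14:
  fixes G :: "'a pair_pre_digraph" and n :: nat
  assumes "pair_graph G"
    and "Digraph_Component.connected (with_proj G)"
    and "card (pverts G) = n"
  shows "properly_quasi_transitively_colourable G \<longleftrightarrow>
    (\<exists>H :: 'a pair_pre_digraph.
       induced_subgraph (with_proj H) (with_proj G) \<and> H \<noteq> G \<and>
       Digraph_Component.connected (with_proj H) \<and>
       2 \<le> card (pverts H) \<and> card (pverts H) \<le> n - 1 \<and>
       (\<forall>v \<in> pverts G - pverts H.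
          (\<exists>w \<in> pverts H. {v, w} \<in> edges G) \<longrightarrow> (\<forall>w \<in> pverts H. {v, w} \<in> edges G)))"
proof -
  interpret pair_graph G by fact
  show ?thesis
    unfolding assms(3)[symmetric] induced_subgraph_iff_connected_module
    using connected_module_imp_colourable[OF assms(2)] colourable_imp_connected_module by blast
qed

end
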